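(* Let $\{\varepsilon_k\}_{k\in\mathbb{N}}\subset(0,1]$ be a sequence converging to $0$, and let $x_k$ be a $T$-periodic solution of $\dot x=f(t,x)+\varepsilon_k g(t,x,\varepsilon_k)$, $k\in\mathbb{N}$, such that $x_k(t)\to\widetilde x(t)$ as $k\to\infty$, where $\widetilde x$ is a $T$-periodic solution of $\dot x=f(t,x)$. Suppose that $$\frac{\widetilde x(0)-x_k(0)}{\|\widetilde x(0)-x_k(0)\|}\to l\quad\text{as }k\to\infty,$$ where $l\in\mathbb{R}^n$. Then either $$\bigl(\Omega'_\xi(T,0,\widetilde x(0))-I\bigr)l=0,$$ or there exists a constant $c>0$ such that $$\|\widetilde x(0)-x_k(0)\|\le c\,\varepsilon_k,\qquad k\in\mathbb{N}.$$ In the latter case, whenever the sequence $\left\{\frac{\widetilde x(0)-x_k(0)}{\varepsilon_k}\right\}_{k\in\mathbb{N}}$ converges, the sequence $\left\{\frac{\widetilde x(0)-\Omega(0,t,x_k(t))}{\varepsilon_k}\right\}_{k\in\mathbb{N}}$ also converges, and $$\bigl(\Omega'_\xi(T,0,\widetilde x(0))-I\bigr)\lim_{k\to\infty}\frac{\widetilde x(0)-\Omega(0,t,x_k(t))}{\varepsilon_k}=\Phi^t(\widetilde x(0)),\qquad t\in[0,T].$$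
   Context: $T>0$; $f:\mathbb{R}\times\mathbb{R}^n\to\mathbb{R}^n$ is continuously differentiable, $g:\mathbb{R}\times\mathbb{R}^n\times[0,1]\to\mathbb{R}^n$ is continuous, both $T$-periodic in the first variable. $\Omega(\cdot,t_0,\xi)$ is the solution of $\dot x=f(t,x)$ with value $\xi$ at time $t_0$; it is assumed that these solutions extend to $[0,T]$ for all $t_0\in[0,T]$, $\xi\in\mathbb{R}^n$. $\Omega'_\xi$ is the derivative of $\Omega$ in its third variable. The generalized averaging operator is $\Phi^s(\xi)=\eta(T,s,\xi)-\eta(0,s,\xi)$, $s\in[0,T]$, where $\eta(\cdot,s,\xi)$ is the solution of $\dot y=f'_x(t,\Omega(t,0,\xi))y+g(t,\Omega(t,0,\xi),0)$ with $\eta(s,s,\xi)=0$ ($f'_x$ is the derivative of $f$ in the second variable). *)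

theory Defs
  imports "HOL-Analysis.Analysis"
begin

definition C1_map :: "('a::real_normed_vector \<Rightarrow> 'b::real_normed_vector) \<Rightarrow> bool" where
  "C1_map h \<longleftrightarrow> (\<exists>h' :: 'a \<Rightarrow> 'a \<Rightarrow>\<^sub>L 'b.
     (\<forall>z. (h has_derivative blinfun_apply (h' z)) (at z)) \<and> continuous_on UNIV h')"

definition solves_ode_on ::
  "(real \<Rightarrow> 'a \<Rightarrow> 'a::real_normed_vector) \<Rightarrow> real set \<Rightarrow> (real \<Rightarrow> 'a) \<Rightarrow> bool" where
  "solves_ode_on F J x \<longleftrightarrow> (\<forall>t\<in>J. (x has_vector_derivative F t (x t)) (at t within J))"

(* Value at time t of the solution of x' = F(t,x) with x(s) = v. Times may lie on either side
   of s. Only the value, not the function, is described by THE: a solution is determined only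
   on the interval between s and t. *)
definition ivp_value ::
  "(real \<Rightarrow> 'a \<Rightarrow> 'a::real_normed_vector) \<Rightarrow> real \<Rightarrow> real \<Rightarrow> 'a \<Rightarrow> 'a" where
  "ivp_value F t s v =
     (THE w. \<exists>x. solves_ode_on F (closed_segment s t) x \<and> x s = v \<and> x t = w)"

abbreviation Omega ::
  "(real \<Rightarrow> 'a \<Rightarrow> 'a::real_normed_vector) \<Rightarrow> real \<Rightarrow> real \<Rightarrow> 'a \<Rightarrow> 'a" where
  "Omega f t t0 \<xi> \<equiv> ivp_value f t t0 \<xi>"

definition Omega_deriv ::
  "(real \<Rightarrow> 'a \<Rightarrow> 'a::real_normed_vector) \<Rightarrow> real \<Rightarrow> real \<Rightarrow> 'a \<Rightarrow> 'a \<Rightarrow> 'a" where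
  "Omega_deriv f t t0 \<xi> = frechet_derivative (\<lambda>z. Omega f t t0 z) (at \<xi>)"

definition eta ::
  "(real \<Rightarrow> 'a \<Rightarrow> 'a::real_normed_vector) \<Rightarrow> (real \<Rightarrow> 'a \<Rightarrow> real \<Rightarrow> 'a) \<Rightarrow>
   real \<Rightarrow> real \<Rightarrow> 'a \<Rightarrow> 'a" where
  "eta f g t s \<xi> = ivp_value
     (\<lambda>\<tau> y. frechet_derivative (f \<tau>) (at (Omega f \<tau> 0 \<xi>)) y + g \<tau> (Omega f \<tau> 0 \<xi>) 0) t s 0"

definition gen_averaging ::
  "real \<Rightarrow> (real \<Rightarrow> 'a \<Rightarrow> 'a::real_normed_vector) \<Rightarrow> (real \<Rightarrow> 'a \<Rightarrow> real \<Rightarrow> 'a) \<Rightarrow>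
   real \<Rightarrow> 'a \<Rightarrow> 'a" where
  "gen_averaging T f g s \<xi> = eta f g T s \<xi> - eta f g 0 s \<xi>"

definition periodic_solution ::
  "real \<Rightarrow> (real \<Rightarrow> 'a \<Rightarrow> 'a::real_normed_vector) \<Rightarrow> (real \<Rightarrow> 'a) \<Rightarrow> bool" where
  "periodic_solution T F x \<longleftrightarrow> solves_ode_on F UNIV x \<and> (\<forall>t. x (t + T) = x t)"

end

theory Submission
  imports Defs
begin

text \<open>
Write p for the unperturbed periodic solution. On the interval from 0 to T, compare p with solutions
u(k) of the equation with right-hand side f + E(k), and divide the difference u(k) - p by a positive
\<mu>(k) that tends to 0. If E(k) / \<mu>(k) converges uniformly to h and the rescaled difference converges at
one time s, then it converges at every time, and the limit solves the linearized equation along p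
with forcing h (lemma \<open>rescaled_difference_limit\<close>). The theorem is this fact applied three times.

For the alternative, suppose that the distances \<mu>(k) = |p(0) - x(k)(0)| are not O(\<epsilon>(k)). Along a
sequence of indices \<epsilon> / \<mu> tends to 0, so the forcing disappears after division by \<mu>. The rescaled differences start
near -l, and by periodicity they also end there; the linearized flow over one period, which is the
derivative of \<Omega>(T, 0, .), therefore fixes l.

For the limit formula take \<mu> = \<epsilon>. The rescaled differences of x(k) converge to a solution y of the
linearized equation with forcing g(., p, 0), and y(T) = y(0). The unperturbed solutions that agree with
x(k) at time t have no forcing; their rescaled differences converge to a homogeneous solution w
with w(t) = y(t). Hence \<open>y - w\<close> is \<open>\<eta>(., t, p(0))\<close>, the limit in question is -w(0), and
\<open>\<Phi>\<close> at time t is (y - w)(T) - (y - w)(0) = w(0) - w(T).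

Everything rests on a Gronwall estimate that confines a difference of solutions to a tube in which
its derivative is controlled (\<open>gronwall_trapped\<close>). It also shows that approximate solutions of the
linearized equation form a Cauchy sequence (\<open>linearized_limit\<close>). Solutions of that equation are thus
obtained as limits of rescaled differences; for the homogeneous equation these are difference
quotients of the flow.
\<close>

section \<open>Elementary properties of solutions\<close>

abbreviation Dx :: "(real \<Rightarrow> 'a \<Rightarrow> 'a::real_normed_vector) \<Rightarrow> real \<Rightarrow> 'a \<Rightarrow> 'a \<Rightarrow> 'a" where
  "Dx f t v \<equiv> frechet_derivative (f t) (at v)"

lemma solves_ode_on_subset:
  assumes "solves_ode_on F J u" "K \<subseteq> J"
  shows "solves_ode_on F K u"
  using assms unfolding solves_ode_on_def
  by (meson has_vector_derivative_within_subset subsetD)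

lemma solves_ode_on_cong:
  assumes "solves_ode_on F J u" "\<And>t. t \<in> J \<Longrightarrow> F t (u t) = G t (u t)"
  shows "solves_ode_on G J u"
  using assms unfolding solves_ode_on_def by simp

lemma solves_ode_on_continuous:
  assumes "solves_ode_on F J u"
  shows "continuous_on J u"
  using assms unfolding solves_ode_on_def
  by (meson continuous_on_eq_continuous_within has_vector_derivative_continuous)

section \<open>Gronwall estimates\<close>

text \<open>Working with the squared norm keeps the quantity differentiable where u vanishes, and
\<open>2 a b \<le> a\<^sup>2 + b\<^sup>2\<close> absorbs the constant term into it. The derivative is only controlled in the open
interval, so that the estimate can be used up to the first time at which a bound is reached.\<close>

lemma gronwall_square:
  fixes u :: "real \<Rightarrow> 'a::real_inner"
  assumes "a \<le> c" and cont: "continuous_on {a..c} u"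
    and der: "\<And>t. a < t \<Longrightarrow> t < c \<Longrightarrow> (u has_vector_derivative u' t) (at t)"
    and bnd: "\<And>t. a < t \<Longrightarrow> t < c \<Longrightarrow> norm (u' t) \<le> L * norm (u t) + \<eta>"
    and "0 \<le> L"
  shows "(norm (u c))\<^sup>2 \<le> exp ((2*L+1) * (c - a)) * ((norm (u a))\<^sup>2 + (c - a) * \<eta>\<^sup>2)"
proof -
  define M where "M = 2*L+1"
  define \<psi> where "\<psi> = (\<lambda>t. exp (- M * (t - a)) * (u t \<bullet> u t) - \<eta>\<^sup>2 * (t - a))"
  have "\<psi> c \<le> \<psi> a"
  proof (rule DERIV_nonpos_imp_decreasing_open[OF \<open>a \<le> c\<close>])
    fix t assume t: "a < t" "t < c"
    have du: "(u has_derivative (\<lambda>h. h *\<^sub>R u' t)) (at t)"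
      using der[OF t] by (simp add: has_vector_derivative_def)
    define D where "D = exp (- M * (t - a)) * (2 * (u t \<bullet> u' t) - M * (u t \<bullet> u t)) - \<eta>\<^sup>2"
    have "(\<psi> has_derivative (\<lambda>h. h * D)) (at t)"
      unfolding \<psi>_def D_def
      by (auto intro!: derivative_eq_intros du simp: algebra_simps inner_commute)
    then have "DERIV \<psi> t :> D"
      by (simp add: has_field_derivative_def mult_commute_abs)
    moreover have "D \<le> 0"
    proof -
      have "u t \<bullet> u' t \<le> norm (u t) * norm (u' t)" by (rule norm_cauchy_schwarz)
      also have "\<dots> \<le> norm (u t) * (L * norm (u t) + \<eta>)"
        by (intro mult_left_mono bnd t) simp
      finally have 1: "2 * (u t \<bullet> u' t) \<le> 2 * L * (norm (u t))\<^sup>2 + 2 * norm (u t) * \<eta>"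
        by (simp add: algebra_simps power2_eq_square)
      have "2 * norm (u t) * \<eta> \<le> (norm (u t))\<^sup>2 + \<eta>\<^sup>2"
        using sum_squares_bound[of "norm (u t)" \<eta>] by simp
      with 1 have 2: "2 * (u t \<bullet> u' t) - M * (u t \<bullet> u t) \<le> \<eta>\<^sup>2"
        by (simp add: M_def algebra_simps power2_norm_eq_inner)
      have "exp (- M * (t - a)) * (2 * (u t \<bullet> u' t) - M * (u t \<bullet> u t)) \<le> exp (- M * (t - a)) * \<eta>\<^sup>2"
        using 2 by (intro mult_left_mono) auto
      also have "\<dots> \<le> 1 * \<eta>\<^sup>2"
        using t \<open>0 \<le> L\<close> by (intro mult_right_mono) (auto simp: M_def intro!: mult_nonpos_nonneg)
      finally show ?thesis by (simp add: D_def)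
    qed
    ultimately show "\<exists>y. DERIV \<psi> t :> y \<and> y \<le> 0" by blast
  next
    show "continuous_on {a..c} \<psi>"
      unfolding \<psi>_def by (intro continuous_intros cont)
  qed
  then have "exp (- (M * (c - a))) * (norm (u c))\<^sup>2 \<le> (norm (u a))\<^sup>2 + (c - a) * \<eta>\<^sup>2"
    by (simp add: \<psi>_def power2_norm_eq_inner algebra_simps)
  then have "exp (M * (c - a)) * (exp (- (M * (c - a))) * (norm (u c))\<^sup>2)
      \<le> exp (M * (c - a)) * ((norm (u a))\<^sup>2 + (c - a) * \<eta>\<^sup>2)"
    by (rule mult_left_mono) simp
  then show ?thesis
    by (simp add: M_def flip: mult.assoc exp_add)
qed

text \<open>A constant that turns the estimate of squares into a linear one: it is at least 1, so it may be
replaced by its square.\<close>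

definition gronwall_const :: "real \<Rightarrow> real \<Rightarrow> real" where
  "gronwall_const L \<tau> = exp ((2*L+1) * \<tau>) * (1 + \<tau>)"

lemma gronwall_const_ge_1: "0 \<le> L \<Longrightarrow> 0 \<le> \<tau> \<Longrightarrow> 1 \<le> gronwall_const L \<tau>"
  unfolding gronwall_const_def
  using mult_mono[of 1 "exp ((2*L+1) * \<tau>)" 1 "1 + \<tau>"] by simp

lemma gronwall_interval:
  fixes u :: "real \<Rightarrow> 'a::real_inner"
  assumes "a \<le> c" "c \<le> b" and cont: "continuous_on {a..c} u"
    and der: "\<And>t. a < t \<Longrightarrow> t < c \<Longrightarrow> (u has_vector_derivative u' t) (at t)"
    and bnd: "\<And>t. a < t \<Longrightarrow> t < c \<Longrightarrow> norm (u' t) \<le> L * norm (u t) + \<eta>"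
    and "0 \<le> L" "0 \<le> \<eta>"
  shows "norm (u c) \<le> gronwall_const L (b - a) * (norm (u a) + \<eta>)"
proof -
  define C where "C = gronwall_const L (b - a)"
  have C: "1 \<le> C" unfolding C_def using assms by (intro gronwall_const_ge_1) auto
  let ?s = "norm (u a) + \<eta>"
  have "(norm (u c))\<^sup>2 \<le> exp ((2*L+1) * (c - a)) * ((norm (u a))\<^sup>2 + (c - a) * \<eta>\<^sup>2)"
    by (rule gronwall_square[OF assms(1) cont der bnd \<open>0 \<le> L\<close>])
  also have "\<dots> \<le> exp ((2*L+1) * (b - a)) * ((1 + (b - a)) * ?s\<^sup>2)"
  proof (rule mult_mono)
    have "(norm (u a))\<^sup>2 \<le> ?s\<^sup>2" "\<eta>\<^sup>2 \<le> ?s\<^sup>2"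
      using \<open>0 \<le> \<eta>\<close> by (auto intro!: power_mono)
    moreover have "(c - a) * \<eta>\<^sup>2 \<le> (b - a) * ?s\<^sup>2"
      using assms calculation by (intro mult_mono) auto
    ultimately show "(norm (u a))\<^sup>2 + (c - a) * \<eta>\<^sup>2 \<le> (1 + (b - a)) * ?s\<^sup>2"
      by (simp add: algebra_simps)
    show "0 \<le> (norm (u a))\<^sup>2 + (c - a) * \<eta>\<^sup>2" using assms by simp
  qed (use assms in \<open>auto intro!: mult_left_mono\<close>)
  also have "\<dots> = C * ?s\<^sup>2" by (simp add: C_def gronwall_const_def)
  also have "\<dots> \<le> C\<^sup>2 * ?s\<^sup>2"
    using C by (intro mult_right_mono) (auto simp: power2_eq_square)
  finally have "(norm (u c))\<^sup>2 \<le> (C * ?s)\<^sup>2" by (simp add: power_mult_distrib)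
  then show ?thesis
    unfolding C_def[symmetric] by (rule power2_le_imp_le) (use C \<open>0 \<le> \<eta>\<close> in auto)
qed

text \<open>The differential inequality is available only while |u| < d. If |u| did reach d, then up to the first
such time the estimate would hold and give a value below d.\<close>

lemma gronwall_trapped_forward:
  fixes u :: "real \<Rightarrow> 'a::real_inner"
  assumes der: "\<And>t. t \<in> {a..b} \<Longrightarrow> (u has_vector_derivative u' t) (at t within {a..b})"
    and bnd: "\<And>t. t \<in> {a..b} \<Longrightarrow> norm (u t) < d \<Longrightarrow> norm (u' t) \<le> L * norm (u t) + \<eta>"
    and "0 \<le> L" "0 \<le> \<eta>"
    and small: "gronwall_const L (b - a) * (norm (u a) + \<eta>) < d"
    and t: "t \<in> {a..b}"
  shows "norm (u t) \<le> gronwall_const L (b - a) * (norm (u a) + \<eta>)"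
proof -
  have contb: "continuous_on {a..b} u"
    using der by (meson continuous_on_eq_continuous_within has_vector_derivative_continuous)
  have der': "(u has_vector_derivative u' t) (at t)" if "a < t" "t < b" for t
    using der[of t] that by (simp add: at_within_Icc_at)
  have trap: "norm (u c) \<le> gronwall_const L (b - a) * (norm (u a) + \<eta>)"
    if "c \<in> {a..b}" "\<And>t. a < t \<Longrightarrow> t < c \<Longrightarrow> norm (u t) < d" for c
  proof (rule gronwall_interval[where u' = u'])
    show "continuous_on {a..c} u" using that(1) by (intro continuous_on_subset[OF contb]) auto
    show "(u has_vector_derivative u' t) (at t)" if "a < t" "t < c" for t
      using der'[of t] that \<open>c \<in> {a..b}\<close> by simp
    show "norm (u' t) \<le> L * norm (u t) + \<eta>" if t: "a < t" "t < c" for t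
      using bnd[of t] \<open>c \<in> {a..b}\<close> t \<open>\<And>t. a < t \<Longrightarrow> t < c \<Longrightarrow> norm (u t) < d\<close>[OF t] by simp
  qed (use that(1) assms(3,4) in auto)
  have inside: "norm (u t) < d" if "t \<in> {a..b}" for t
  proof (rule ccontr)
    assume "\<not> norm (u t) < d"
    define S where "S = {t \<in> {a..b}. d \<le> norm (u t)}"
    have "closed S" unfolding S_def
      by (intro continuous_on_closed_Collect_le continuous_intros contb)
    moreover have "bounded S" unfolding S_def by (rule bounded_subset[of "{a..b}"]) auto
    moreover have "S \<noteq> {}" using that \<open>\<not> norm (u t) < d\<close> by (auto simp: S_def)
    ultimately obtain c where c: "c \<in> S" "\<And>t. t \<in> S \<Longrightarrow> c \<le> t"
      by (metis compact_attains_inf compact_eq_bounded_closed)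
    have "norm (u c) \<le> gronwall_const L (b - a) * (norm (u a) + \<eta>)"
    proof (rule trap)
      show "norm (u t) < d" if "a < t" "t < c" for t
        using that c(1) c(2)[of t] by (force simp: S_def)
    qed (use c in \<open>auto simp: S_def\<close>)
    with small c(1) show False by (simp add: S_def)
  qed
  show ?thesis using t by (intro trap inside) auto
qed

text \<open>An initial time inside the interval is needed later, since averaging starts at an arbitrary t.
Times before s follow by reversing the direction of time.\<close>

lemma gronwall_trapped:
  fixes u :: "real \<Rightarrow> 'a::real_inner"
  assumes der: "\<And>t. t \<in> {a..b} \<Longrightarrow> (u has_vector_derivative u' t) (at t within {a..b})"
    and bnd: "\<And>t. t \<in> {a..b} \<Longrightarrow> norm (u t) < d \<Longrightarrow> norm (u' t) \<le> L * norm (u t) + \<eta>"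
    and "0 \<le> L" "0 \<le> \<eta>"
    and small: "gronwall_const L (b - a) * (norm (u s) + \<eta>) < d"
    and s: "s \<in> {a..b}" and t: "t \<in> {a..b}"
  shows "norm (u t) \<le> gronwall_const L (b - a) * (norm (u s) + \<eta>)"
proof -
  have mono: "gronwall_const L \<tau> * (norm (u s) + \<eta>) \<le> gronwall_const L (b - a) * (norm (u s) + \<eta>)"
    if "0 \<le> \<tau>" "\<tau> \<le> b - a" for \<tau>
    unfolding gronwall_const_def using that assms(3,4)
    by (intro mult_right_mono mult_mono) (auto intro!: mult_left_mono)
  show ?thesis
  proof (cases "s \<le> t")
    case True
    have "norm (u t) \<le> gronwall_const L (b - s) * (norm (u s) + \<eta>)"
    proof (rule gronwall_trapped_forward[where u' = u' and d = d])
      show "(u has_vector_derivative u' t) (at t within {s..b})" if "t \<in> {s..b}" for t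
        using has_vector_derivative_within_subset[OF der[of t], of "{s..b}"] that s by auto
      show "norm (u' t) \<le> L * norm (u t) + \<eta>" if "t \<in> {s..b}" "norm (u t) < d" for t
        using bnd that s by auto
      show "gronwall_const L (b - s) * (norm (u s) + \<eta>) < d"
        using mono[of "b - s"] small s by auto
    qed (use True t assms(3,4) in auto)
    also have "\<dots> \<le> gronwall_const L (b - a) * (norm (u s) + \<eta>)" using mono[of "b - s"] s by auto
    finally show ?thesis .
  next
    case False
    define w where "w = (\<lambda>t. u (- t))"
    have "norm (w (- t)) \<le> gronwall_const L (- a - (- s)) * (norm (w (- s)) + \<eta>)"
    proof (rule gronwall_trapped_forward[where u' = "\<lambda>t. - u' (- t)" and d = d])
      show "(w has_vector_derivative - u' (- t)) (at t within {- s..- a})"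
        if t: "t \<in> {- s..- a}" for t
      proof -
        have "(u has_vector_derivative u' (- t)) (at (- t) within uminus ` {- s..- a})"
          using t s by (intro has_vector_derivative_within_subset[OF der]) auto
        then have "((u \<circ> uminus) has_vector_derivative (- 1) *\<^sub>R u' (- t)) (at t within {- s..- a})"
          by (intro vector_diff_chain_within) (auto intro!: derivative_eq_intros)
        then show ?thesis by (simp add: w_def o_def)
      qed
      show "norm (- u' (- t)) \<le> L * norm (w t) + \<eta>" if "t \<in> {- s..- a}" "norm (w t) < d" for t
        using bnd[of "- t"] that s by (auto simp: w_def)
      show "gronwall_const L (- a - - s) * (norm (w (- s)) + \<eta>) < d"
        using mono[of "s - a"] small s by (auto simp: w_def)
    qed (use False t assms(3,4) in auto)
    also have "\<dots> \<le> gronwall_const L (b - a) * (norm (u s) + \<eta>)"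
      using mono[of "s - a"] s by (auto simp: w_def)
    finally show ?thesis by (simp add: w_def)
  qed
qed

section \<open>The derivative of the vector field in the state variable\<close>

lemma C1_map_second_argument:
  fixes f :: "real \<Rightarrow> 'a::real_normed_vector \<Rightarrow> 'a"
  assumes "\<And>z. ((\<lambda>(t, v). f t v) has_derivative blinfun_apply (f' z)) (at z)"
  shows "(f t has_derivative (\<lambda>y. blinfun_apply (f' (t, v)) (0, y))) (at v)"
proof -
  have "((\<lambda>v. (t, v)) has_derivative (\<lambda>y. (0, y))) (at v)"
    by (auto intro!: derivative_eq_intros)
  from has_derivative_compose[OF this assms] show ?thesis by simp
qed

lemma Dx_has_derivative:
  assumes "C1_map (\<lambda>(t, v). f t v)"
  shows "(f t has_derivative Dx f t v) (at v)"
proof -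
  have "f t differentiable at v"
    using assms C1_map_second_argument unfolding C1_map_def differentiable_def by blast
  then show ?thesis by (simp add: frechet_derivative_works)
qed

lemma Dx_linear:
  assumes "C1_map (\<lambda>(t, v). f t v)"
  shows "linear (Dx f t v)"
  using Dx_has_derivative[OF assms] has_derivative_linear by blast

lemma Dx_bounded_along_curve:
  fixes f :: "real \<Rightarrow> 'a::euclidean_space \<Rightarrow> 'a"
  assumes C1: "C1_map (\<lambda>(t, v). f t v)" and p: "continuous_on {a..b} p"
  shows "\<exists>L\<ge>0. \<forall>t\<in>{a..b}. \<forall>y. norm (Dx f t (p t) y) \<le> L * norm y"
proof -
  obtain f' where f': "\<And>z. ((\<lambda>(t, v). f t v) has_derivative blinfun_apply (f' z)) (at z)"
    "continuous_on UNIV f'" using C1 unfolding C1_map_def by blast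
  have Dx: "Dx f t v = (\<lambda>y. blinfun_apply (f' (t, v)) (0, y))" for t v
    using C1_map_second_argument[OF f'(1)] frechet_derivative_at by metis
  have "compact ((\<lambda>t. f' (t, p t)) ` {a..b})"
    by (intro compact_continuous_image continuous_on_compose2[OF f'(2)] continuous_intros p) auto
  then have "bounded ((\<lambda>t. f' (t, p t)) ` {a..b})" by (rule compact_imp_bounded)
  then obtain L where L: "L > 0" "\<And>t. t \<in> {a..b} \<Longrightarrow> norm (f' (t, p t)) \<le> L"
    unfolding bounded_pos by blast
  have "norm (Dx f t (p t) y) \<le> L * norm y" if "t \<in> {a..b}" for t y
  proof -
    have "norm (Dx f t (p t) y) \<le> norm (f' (t, p t)) * norm (0 :: real, y)"
      unfolding Dx by (rule norm_blinfun)
    also have "\<dots> \<le> L * norm y" using L(2)[OF that] by (simp add: norm_Pair mult_right_mono)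
    finally show ?thesis .
  qed
  then show ?thesis using L(1) by (intro exI[of _ L]) auto
qed

text \<open>The derivative of f is uniformly continuous on the compact tube of radius 1 around the curve, so the
mean value inequality on balls gives a remainder that is uniform in t.\<close>

lemma taylor_uniform_along_curve:
  fixes f :: "real \<Rightarrow> 'a::euclidean_space \<Rightarrow> 'a"
  assumes C1: "C1_map (\<lambda>(t, v). f t v)" and p: "continuous_on {a..b} p" and "e > 0"
  shows "\<exists>d>0. \<forall>t\<in>{a..b}. \<forall>v. norm (v - p t) < d \<longrightarrow>
     norm (f t v - f t (p t) - Dx f t (p t) (v - p t)) \<le> e * norm (v - p t)"
proof -
  obtain f' where f': "\<And>z. ((\<lambda>(t, v). f t v) has_derivative blinfun_apply (f' z)) (at z)"
    "continuous_on UNIV f'" using C1 unfolding C1_map_def by blast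
  note der = C1_map_second_argument[OF f'(1)]
  have Dx: "Dx f t v = (\<lambda>y. blinfun_apply (f' (t, v)) (0, y))" for t v
    using der frechet_derivative_at by metis
  define K where "K = (\<lambda>(t, w). (t, p t + w)) ` ({a..b} \<times> cball (0::'a) 1)"
  have "continuous_on ({a..b} \<times> cball (0::'a) 1) (\<lambda>x. (fst x, p (fst x) + snd x))"
    by (intro continuous_intros continuous_on_compose2[OF p]) auto
  then have "compact K" unfolding K_def split_def
    by (intro compact_continuous_image compact_Times) auto
  then have "uniformly_continuous_on K f'"
    using continuous_on_subset[OF f'(2)] by (intro compact_uniformly_continuous) auto
  then obtain d where d: "d > 0"
    "\<And>z z'. z \<in> K \<Longrightarrow> z' \<in> K \<Longrightarrow> dist z' z < d \<Longrightarrow> dist (f' z') (f' z) < e"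
    using \<open>e > 0\<close> unfolding uniformly_continuous_on_def by metis
  \<comment> \<open>Radius at most 1, so that the balls stay in the tube K.\<close>
  define r where "r = min d 1"
  have "norm (f t v - f t (p t) - Dx f t (p t) (v - p t)) \<le> e * norm (v - p t)"
    if t: "t \<in> {a..b}" and v: "norm (v - p t) < r" for t v
  proof -
    have K: "(t, z) \<in> K" if "z \<in> ball (p t) r" for z
      using t that unfolding K_def
      by (intro image_eqI[of _ _ "(t, z - p t)"]) (auto simp: r_def dist_norm norm_minus_commute)
    have ineq: "onorm (Dx f t z - Dx f t (p t)) \<le> e" if "z \<in> ball (p t) r" for z
    proof (rule onorm_le)
      fix y
      have "p t \<in> ball (p t) r" using that by (auto simp: r_def d)
      moreover have "dist (t, z) (t, p t) < d"
        using that by (simp add: dist_Pair_Pair r_def dist_commute)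
      ultimately have "dist (f' (t, z)) (f' (t, p t)) < e" using that by (intro d K)
      then have *: "norm (f' (t, z) - f' (t, p t)) \<le> e" by (simp add: dist_norm)
      have "norm ((Dx f t z - Dx f t (p t)) y)
          = norm (blinfun_apply (f' (t, z) - f' (t, p t)) (0, y))"
        by (simp add: Dx minus_blinfun.rep_eq)
      also have "\<dots> \<le> norm (f' (t, z) - f' (t, p t)) * norm (0 :: real, y)" by (rule norm_blinfun)
      also have "\<dots> \<le> e * norm y" using * by (simp add: norm_Pair mult_right_mono)
      finally show "norm ((Dx f t z - Dx f t (p t)) y) \<le> e * norm y" .
    qed
    have "norm (f t v - f t (p t) - Dx f t (p t) (v - p t)) \<le> norm (v - p t) * e"
    proof (rule differentiable_bound_linearization[where S = "ball (p t) r" and f = "f t"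
          and f' = "Dx f t" and ?x0.0 = "p t"])
      show "p t + s *\<^sub>R (v - p t) \<in> ball (p t) r" if "s \<in> {0..1}" for s
      proof -
        have "\<bar>s\<bar> * norm (v - p t) \<le> 1 * norm (v - p t)"
          using that by (intro mult_right_mono) auto
        then show ?thesis using v by (simp add: dist_norm)
      qed
      show "(f t has_derivative Dx f t z) (at z within ball (p t) r)" for z
        using Dx_has_derivative[OF C1] has_derivative_at_withinI by blast
      show "p t \<in> ball (p t) r" using d by (simp add: r_def)
    qed (rule ineq)
    then show ?thesis by (simp add: mult.commute)
  qed
  moreover have "r > 0" using d by (simp add: r_def)
  ultimately show ?thesis by blast
qed

section \<open>Continuous dependence and uniqueness\<close>

text \<open>The perturbation E is bounded only where u is near p: for a solution u of the perturbed equation,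
E is g evaluated along u, and nothing is known about g along u until u is known to stay near p.\<close>

definition perturbation_bound ::
  "(real \<Rightarrow> 'a \<Rightarrow> 'a::real_normed_vector) \<Rightarrow> real set \<Rightarrow> (real \<Rightarrow> 'a) \<Rightarrow> real \<Rightarrow> real \<Rightarrow> bool" where
  "perturbation_bound f J p C d \<longleftrightarrow> (\<forall>u E \<eta>. solves_ode_on (\<lambda>t v. f t v + E t) J u \<longrightarrow>
     (\<forall>t\<in>J. norm (u t - p t) < 1 \<longrightarrow> norm (E t) \<le> \<eta>) \<longrightarrow> 0 \<le> \<eta> \<longrightarrow>
     (\<forall>s\<in>J. norm (u s - p s) + \<eta> < d \<longrightarrow>
        (\<forall>t\<in>J. norm (u t - p t) \<le> C * (norm (u s - p s) + \<eta>))))"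

lemma perturbation_boundD:
  assumes "perturbation_bound f J p C d" "solves_ode_on (\<lambda>t v. f t v + E t) J u"
    "\<And>t. t \<in> J \<Longrightarrow> norm (u t - p t) < 1 \<Longrightarrow> norm (E t) \<le> \<eta>" "0 \<le> \<eta>"
    "s \<in> J" "norm (u s - p s) + \<eta> < d" "t \<in> J"
  shows "norm (u t - p t) \<le> C * (norm (u s - p s) + \<eta>)"
  using assms unfolding perturbation_bound_def by blast

text \<open>First-order expansion with error constant 1 gives the Lipschitz constant L + 1 near p; the threshold
on the data ensures that the Gronwall bound keeps u in the tube where it is valid.\<close>

lemma perturbation_bound_exists:
  fixes f :: "real \<Rightarrow> 'a::euclidean_space \<Rightarrow> 'a"
  assumes C1: "C1_map (\<lambda>(t, v). f t v)" and p: "solves_ode_on f {a..b} p" and "a \<le> b"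
  obtains C d where "0 \<le> C" "0 < d" "perturbation_bound f {a..b} p C d"
proof -
  have pc: "continuous_on {a..b} p" using p by (rule solves_ode_on_continuous)
  obtain L where L: "L \<ge> 0" "\<And>t y. t \<in> {a..b} \<Longrightarrow> norm (Dx f t (p t) y) \<le> L * norm y"
    using Dx_bounded_along_curve[OF C1 pc] by blast
  obtain d where d: "d > 0" "\<And>t v. t \<in> {a..b} \<Longrightarrow> norm (v - p t) < d \<Longrightarrow>
     norm (f t v - f t (p t) - Dx f t (p t) (v - p t)) \<le> 1 * norm (v - p t)"
    using taylor_uniform_along_curve[OF C1 pc, of 1] by auto
  define r where "r = min d 1"
  define C where "C = gronwall_const (L + 1) (b - a)"
  have C: "C \<ge> 1" unfolding C_def using L \<open>a \<le> b\<close> by (intro gronwall_const_ge_1) auto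
  have "norm (u t - p t) \<le> C * (norm (u s - p s) + \<eta>)"
    if s: "s \<in> {a..b}" and u: "solves_ode_on (\<lambda>t v. f t v + E t) {a..b} u"
      and E: "\<And>t. t \<in> {a..b} \<Longrightarrow> norm (u t - p t) < 1 \<Longrightarrow> norm (E t) \<le> \<eta>" and "0 \<le> \<eta>"
      and sm: "norm (u s - p s) + \<eta> < r / C" and t: "t \<in> {a..b}" for u E s \<eta> t
    unfolding C_def
  proof (rule gronwall_trapped[where u' = "\<lambda>t. f t (u t) + E t - f t (p t)" and d = r])
    show "((\<lambda>t. u t - p t) has_vector_derivative f t (u t) + E t - f t (p t)) (at t within {a..b})"
      if "t \<in> {a..b}" for t
      using u p that unfolding solves_ode_on_def by (intro has_vector_derivative_diff) auto
    show "norm (f t (u t) + E t - f t (p t)) \<le> (L + 1) * norm (u t - p t) + \<eta>"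
      if "t \<in> {a..b}" "norm (u t - p t) < r" for t
    proof -
      have eq: "f t (u t) + E t - f t (p t) =
          (f t (u t) - f t (p t) - Dx f t (p t) (u t - p t)) + Dx f t (p t) (u t - p t) + E t"
        by simp
      have "norm (f t (u t) - f t (p t) - Dx f t (p t) (u t - p t)) \<le> norm (u t - p t)"
        "norm (Dx f t (p t) (u t - p t)) \<le> L * norm (u t - p t)" "norm (E t) \<le> \<eta>"
        using d(2)[of t "u t"] L(2) E that by (auto simp: r_def)
      then show ?thesis
        unfolding eq by (intro norm_triangle_le add_mono) (auto intro!: norm_triangle_le simp: algebra_simps)
    qed
    show "gronwall_const (L + 1) (b - a) * (norm (u s - p s) + \<eta>) < r"
      using sm C unfolding C_def[symmetric] by (simp add: pos_less_divide_eq mult.commute)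
  qed (use L \<open>0 \<le> \<eta>\<close> s t in auto)
  then have "perturbation_bound f {a..b} p C (r / C)"
    unfolding perturbation_bound_def by blast
  moreover have "r / C > 0" using C d by (simp add: r_def)
  ultimately show thesis using C by (intro that[of C "r / C"]) auto
qed

text \<open>Uniqueness is asked for on subintervals because the description of the value only mentions
solutions on the segment between s and t, which need not extend further.\<close>

lemma ivp_value_eq:
  assumes y: "solves_ode_on F {a..b} y" and s: "s \<in> {a..b}" and t: "t \<in> {a..b}"
    and unique: "\<And>c d z. c \<le> d \<Longrightarrow> {c..d} \<subseteq> {a..b} \<Longrightarrow> s \<in> {c..d} \<Longrightarrow> t \<in> {c..d} \<Longrightarrow>
      solves_ode_on F {c..d} z \<Longrightarrow> z s = y s \<Longrightarrow> z t = y t"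
  shows "ivp_value F t s (y s) = y t"
  unfolding ivp_value_def
proof (rule the_equality)
  let ?S = "closed_segment s t"
  have S: "?S = {min s t..max s t}" by (auto simp: closed_segment_eq_real_ivl)
  have sub: "?S \<subseteq> {a..b}" using s t unfolding S by auto
  show "\<exists>x. solves_ode_on F ?S x \<and> x s = y s \<and> x t = y t"
    using solves_ode_on_subset[OF y sub] by blast
  show "w = y t" if "\<exists>x. solves_ode_on F ?S x \<and> x s = y s \<and> x t = w" for w
    using that sub unfolding S by (elim exE conjE) (use unique[of "min s t" "max s t"] in force)
qed

lemma Omega_eq:
  fixes f :: "real \<Rightarrow> 'a::euclidean_space \<Rightarrow> 'a"
  assumes C1: "C1_map (\<lambda>(t, v). f t v)" and p: "solves_ode_on f {a..b} p"
    and s: "s \<in> {a..b}" and t: "t \<in> {a..b}"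
  shows "Omega f t s (p s) = p t"
proof (rule ivp_value_eq[OF p s t])
  fix c d z
  assume cd: "c \<le> d" "{c..d} \<subseteq> {a..b}" and st: "s \<in> {c..d}" "t \<in> {c..d}"
    and z: "solves_ode_on f {c..d} z" and eq: "z s = p s"
  obtain C r where "0 < r" and C: "perturbation_bound f {c..d} p C r"
    using perturbation_bound_exists[OF C1 solves_ode_on_subset[OF p cd(2)] cd(1)] by metis
  have "norm (z t - p t) \<le> C * (norm (z s - p s) + 0)"
    by (rule perturbation_boundD[OF C, of "\<lambda>_. 0"]) (use z st eq \<open>0 < r\<close> in auto)
  then show "z t = p t" using eq by simp
qed

section \<open>The linearized equation\<close>

abbreviation linearized ::
  "(real \<Rightarrow> 'a \<Rightarrow> 'a::real_normed_vector) \<Rightarrow> (real \<Rightarrow> 'a) \<Rightarrow> (real \<Rightarrow> 'a) \<Rightarrow> real \<Rightarrow> 'a \<Rightarrow> 'a" where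
  "linearized f p b \<equiv> \<lambda>t y. Dx f t (p t) y + b t"

lemma linearized_combine:
  assumes C1: "C1_map (\<lambda>(t, v). f t v)"
    and "solves_ode_on (linearized f p b) J y" "solves_ode_on (linearized f p c) J z"
  shows "solves_ode_on (linearized f p (\<lambda>t. \<alpha> *\<^sub>R b t + \<beta> *\<^sub>R c t)) J (\<lambda>t. \<alpha> *\<^sub>R y t + \<beta> *\<^sub>R z t)"
  unfolding solves_ode_on_def
proof
  fix t assume "t \<in> J"
  then have "((\<lambda>t. \<alpha> *\<^sub>R y t + \<beta> *\<^sub>R z t) has_vector_derivative
      \<alpha> *\<^sub>R (Dx f t (p t) (y t) + b t) + \<beta> *\<^sub>R (Dx f t (p t) (z t) + c t)) (at t within J)"
    using assms(2,3) unfolding solves_ode_on_def by (auto intro!: derivative_eq_intros)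
  then show "((\<lambda>t. \<alpha> *\<^sub>R y t + \<beta> *\<^sub>R z t) has_vector_derivative
      Dx f t (p t) (\<alpha> *\<^sub>R y t + \<beta> *\<^sub>R z t) + (\<alpha> *\<^sub>R b t + \<beta> *\<^sub>R c t)) (at t within J)"
    using Dx_linear[OF C1, of t "p t"] by (simp add: linear_add linear_scale algebra_simps)
qed

lemma linearized_diff:
  assumes C1: "C1_map (\<lambda>(t, v). f t v)"
    and "solves_ode_on (linearized f p b) J y" "solves_ode_on (linearized f p c) J z"
  shows "solves_ode_on (linearized f p (\<lambda>t. b t - c t)) J (\<lambda>t. y t - z t)"
  using linearized_combine[OF assms, of 1 "-1"] by simp

definition linearized_bound ::
  "(real \<Rightarrow> 'a \<Rightarrow> 'a::real_normed_vector) \<Rightarrow> real set \<Rightarrow> (real \<Rightarrow> 'a) \<Rightarrow> real \<Rightarrow> bool" where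
  "linearized_bound f J p C \<longleftrightarrow> (\<forall>y c \<eta>. solves_ode_on (linearized f p c) J y \<longrightarrow>
     (\<forall>t\<in>J. norm (c t) \<le> \<eta>) \<longrightarrow> (\<forall>s\<in>J. \<forall>t\<in>J. norm (y t) \<le> C * (norm (y s) + \<eta>)))"

lemma linearized_boundD:
  assumes "linearized_bound f J p C" "solves_ode_on (linearized f p c) J y"
    "\<And>t. t \<in> J \<Longrightarrow> norm (c t) \<le> \<eta>" "s \<in> J" "t \<in> J"
  shows "norm (y t) \<le> C * (norm (y s) + \<eta>)"
  using assms unfolding linearized_bound_def by blast

text \<open>The inequality holds everywhere here, so any trap radius above the final bound will do.\<close>

lemma linearized_bound_exists:
  fixes f :: "real \<Rightarrow> 'a::euclidean_space \<Rightarrow> 'a"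
  assumes C1: "C1_map (\<lambda>(t, v). f t v)" and p: "continuous_on {a..b} p" and "a \<le> b"
  obtains C where "0 \<le> C" "linearized_bound f {a..b} p C"
proof -
  obtain L where L: "L \<ge> 0" "\<And>t y. t \<in> {a..b} \<Longrightarrow> norm (Dx f t (p t) y) \<le> L * norm y"
    using Dx_bounded_along_curve[OF C1 p] by blast
  have "norm (y t) \<le> gronwall_const L (b - a) * (norm (y s) + \<eta>)"
    if s: "s \<in> {a..b}" and y: "solves_ode_on (linearized f p c) {a..b} y"
      and c: "\<And>t. t \<in> {a..b} \<Longrightarrow> norm (c t) \<le> \<eta>" and t: "t \<in> {a..b}" for y c s \<eta> t
  proof (rule gronwall_trapped[where u' = "\<lambda>t. Dx f t (p t) (y t) + c t"
        and d = "gronwall_const L (b - a) * (norm (y s) + \<eta>) + 1"])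
    show "norm (Dx f t (p t) (y t) + c t) \<le> L * norm (y t) + \<eta>" if "t \<in> {a..b}" for t
      using L(2)[OF that, of "y t"] c that by (intro norm_triangle_le) fastforce
    show "0 \<le> \<eta>" using c[OF s] norm_ge_zero order_trans by blast
  qed (use y L s t in \<open>auto simp: solves_ode_on_def\<close>)
  then have "linearized_bound f {a..b} p (gronwall_const L (b - a))"
    unfolding linearized_bound_def by blast
  moreover have "gronwall_const L (b - a) \<ge> 0"
    using gronwall_const_ge_1[of L "b - a"] L(1) \<open>a \<le> b\<close> by simp
  ultimately show thesis using that by blast
qed

lemma linearized_unique:
  fixes f :: "real \<Rightarrow> 'a::euclidean_space \<Rightarrow> 'a"
  assumes C1: "C1_map (\<lambda>(t, v). f t v)" and p: "continuous_on {a..b} p"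
    and y: "solves_ode_on (linearized f p c) {a..b} y"
    and z: "solves_ode_on (linearized f p c) {a..b} z"
    and s: "s \<in> {a..b}" and eq: "y s = z s" and t: "t \<in> {a..b}"
  shows "y t = z t"
proof -
  have "a \<le> b" using s by simp
  obtain C where C: "linearized_bound f {a..b} p C"
    using linearized_bound_exists[OF C1 p \<open>a \<le> b\<close>] by metis
  show ?thesis
    using linearized_boundD[OF C linearized_diff[OF C1 y z], of 0 s t] eq s t by simp
qed

text \<open>Approximate solutions converge because the difference of two of them solves the linearized equation
with small forcing and small initial value, which the a priori bound turns into a uniform Cauchy
property. The equation passes to the limit since the derivatives then converge uniformly as well.
Existence of a solution y with the limiting initial value is part of the outcome.\<close>

lemma linearized_limit:
  fixes f :: "real \<Rightarrow> 'a::euclidean_space \<Rightarrow> 'a"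
  assumes C1: "C1_map (\<lambda>(t, v). f t v)" and p: "continuous_on {a..b} p" and s: "s \<in> {a..b}"
    and z: "\<And>k. solves_ode_on (linearized f p (c k)) {a..b} (z k)"
    and c: "uniform_limit {a..b} c b' sequentially"
    and init: "(\<lambda>k. z k s) \<longlonglongrightarrow> \<xi>"
  shows "\<exists>y. solves_ode_on (linearized f p b') {a..b} y \<and> y s = \<xi> \<and> (\<forall>t\<in>{a..b}. (\<lambda>k. z k t) \<longlonglongrightarrow> y t)"
proof -
  have "a \<le> b" using s by simp
  obtain C where C: "C \<ge> 0" "linearized_bound f {a..b} p C"
    using linearized_bound_exists[OF C1 p \<open>a \<le> b\<close>] by metis
  obtain L where L: "L \<ge> 0" "\<And>t y. t \<in> {a..b} \<Longrightarrow> norm (Dx f t (p t) y) \<le> L * norm y"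
    using Dx_bounded_along_curve[OF C1 p] by blast
  have "uniformly_Cauchy_on {a..b} c"
    using c uniformly_convergent_Cauchy uniformly_convergent_on_def by blast
  have "uniformly_Cauchy_on {a..b} z"
    unfolding uniformly_Cauchy_on_def
  proof (intro allI impI)
    fix e :: real assume "e > 0"
    define e' where "e' = e / (2 * (C + 1))"
    have "e' > 0" using C \<open>e > 0\<close> by (simp add: e'_def)
    obtain M1 where M1: "\<And>m n t. m \<ge> M1 \<Longrightarrow> n \<ge> M1 \<Longrightarrow> t \<in> {a..b} \<Longrightarrow> dist (c m t) (c n t) < e'"
      using \<open>uniformly_Cauchy_on {a..b} c\<close> \<open>e' > 0\<close> unfolding uniformly_Cauchy_on_def by metis
    obtain M2 where M2: "\<And>m n. m \<ge> M2 \<Longrightarrow> n \<ge> M2 \<Longrightarrow> dist (z m s) (z n s) < e'"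
      using LIMSEQ_imp_Cauchy[OF init] \<open>e' > 0\<close> unfolding Cauchy_def by metis
    have "dist (z m t) (z n t) < e" if "m \<ge> max M1 M2" "n \<ge> max M1 M2" "t \<in> {a..b}" for m n t
    proof -
      have "norm (z m t - z n t) \<le> C * (norm (z m s - z n s) + e')"
        using M1[of m n] that s
        by (intro linearized_boundD[OF C(2) linearized_diff[OF C1 z z]])
          (auto simp: dist_norm intro!: less_imp_le)
      also have "\<dots> \<le> C * (2 * e')"
        using M2[of m n] that C(1) by (intro mult_left_mono) (auto simp: dist_norm)
      also have "\<dots> < (C + 1) * (2 * e')" using \<open>e' > 0\<close> by simp
      also have "\<dots> = e" using C(1) by (simp add: e'_def field_simps)
      finally show ?thesis by (simp add: dist_norm)
    qed
    then show "\<exists>M. \<forall>t\<in>{a..b}. \<forall>m\<ge>M. \<forall>n\<ge>M. dist (z m t) (z n t) < e" by blast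
  qed
  then obtain y where y: "uniform_limit {a..b} z y sequentially"
    using Cauchy_uniformly_convergent uniformly_convergent_on_def by blast
  have lim: "(\<lambda>k. z k t) \<longlonglongrightarrow> y t" if "t \<in> {a..b}" for t
    using tendsto_uniform_limitI[OF y that] .
  have "\<exists>w. \<forall>t\<in>{a..b}. (\<lambda>k. z k t) \<longlonglongrightarrow> w t \<and>
      (w has_derivative (\<lambda>h. h *\<^sub>R (Dx f t (p t) (y t) + b' t))) (at t within {a..b})"
  proof (rule has_derivative_sequence[where f = z and ?x0.0 = s and l = \<xi> and S = "{a..b}"
        and f' = "\<lambda>k t h. h *\<^sub>R (Dx f t (p t) (z k t) + c k t)"])
    show "convex {a..b}" by simp
    show "(z k has_derivative (\<lambda>h. h *\<^sub>R (Dx f t (p t) (z k t) + c k t))) (at t within {a..b})"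
      if "t \<in> {a..b}" for k t
      using z[of k] that by (auto simp: solves_ode_on_def has_vector_derivative_def)
    fix e :: real assume "e > 0"
    define e' where "e' = e / (L + 1)"
    have "e' > 0" using L \<open>e > 0\<close> by (simp add: e'_def)
    have "\<forall>\<^sub>F k in sequentially. \<forall>t\<in>{a..b}. dist (z k t) (y t) < e'"
      "\<forall>\<^sub>F k in sequentially. \<forall>t\<in>{a..b}. dist (c k t) (b' t) < e'"
      using y c \<open>e' > 0\<close> unfolding uniform_limit_iff by auto
    then show "\<forall>\<^sub>F k in sequentially. \<forall>t\<in>{a..b}. \<forall>h. norm (h *\<^sub>R (Dx f t (p t) (z k t) + c k t)
        - h *\<^sub>R (Dx f t (p t) (y t) + b' t)) \<le> e * norm h"
    proof eventually_elim
      case (elim k)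
      show ?case
      proof (intro ballI allI)
        fix t h assume t: "t \<in> {a..b}"
        have "norm ((Dx f t (p t) (z k t) + c k t) - (Dx f t (p t) (y t) + b' t))
            = norm (Dx f t (p t) (z k t - y t) + (c k t - b' t))"
          by (simp add: linear_diff[OF Dx_linear[OF C1]] algebra_simps)
        also have "\<dots> \<le> L * e' + e'"
        proof (rule norm_triangle_mono)
          show "norm (Dx f t (p t) (z k t - y t)) \<le> L * e'"
            using L(2)[OF t, of "z k t - y t"] elim(1) t L(1)
            by (force simp: dist_norm intro: order_trans mult_left_mono less_imp_le)
          show "norm (c k t - b' t) \<le> e'" using elim(2) t by (auto simp: dist_norm less_imp_le)
        qed
        also have "\<dots> = (L + 1) * e'" by (simp add: algebra_simps)
        also have "\<dots> = e" using L(1) by (simp add: e'_def)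
        finally show "norm (h *\<^sub>R (Dx f t (p t) (z k t) + c k t)
            - h *\<^sub>R (Dx f t (p t) (y t) + b' t)) \<le> e * norm h"
          using mult_left_mono[of _ e "norm h"]
          by (simp add: mult.commute[of e] flip: scaleR_diff_right)
      qed
    qed
  next
    show "s \<in> {a..b}" "(\<lambda>k. z k s) \<longlonglongrightarrow> \<xi>" by (fact s init)+
  qed
  then obtain w where w: "\<And>t. t \<in> {a..b} \<Longrightarrow> (\<lambda>k. z k t) \<longlonglongrightarrow> w t"
    "\<And>t. t \<in> {a..b} \<Longrightarrow> (w has_vector_derivative Dx f t (p t) (y t) + b' t) (at t within {a..b})"
    unfolding has_vector_derivative_def by blast
  have wy: "w t = y t" if "t \<in> {a..b}" for t
    using w(1)[OF that] lim[OF that] LIMSEQ_unique by blast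
  have "solves_ode_on (linearized f p b') {a..b} w"
    unfolding solves_ode_on_def using w(2) wy by simp
  moreover have "w s = \<xi>" using w(1)[OF s] init LIMSEQ_unique by blast
  ultimately show ?thesis using w(1) by blast
qed

section \<open>Rescaled differences of nearby solutions\<close>

text \<open>The rescaled difference solves the linearized equation exactly if the Taylor remainder R, divided by
\<mu>, is counted as forcing. Continuous dependence gives a difference of order \<mu>, so R / \<mu> tends to 0
uniformly.\<close>

lemma rescaled_difference_limit:
  fixes f :: "real \<Rightarrow> 'a::euclidean_space \<Rightarrow> 'a"
  assumes C1: "C1_map (\<lambda>(t, v). f t v)" and p: "solves_ode_on f {a..b} p" and s: "s \<in> {a..b}"
    and u: "\<And>k. solves_ode_on (\<lambda>t v. f t v + E k t) {a..b} (u k)"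
    and \<mu>: "\<And>k. 0 < \<mu> k" "\<mu> \<longlonglongrightarrow> 0"
    and E: "uniform_limit {a..b} (\<lambda>k t. E k t /\<^sub>R \<mu> k) h sequentially"
    and h: "bounded (h ` {a..b})"
    and init: "(\<lambda>k. (u k s - p s) /\<^sub>R \<mu> k) \<longlonglongrightarrow> \<xi>"
  obtains y where "solves_ode_on (linearized f p h) {a..b} y" "y s = \<xi>"
    "\<And>t. t \<in> {a..b} \<Longrightarrow> (\<lambda>k. (u k t - p t) /\<^sub>R \<mu> k) \<longlonglongrightarrow> y t"
proof -
  have "a \<le> b" using s by simp
  have pc: "continuous_on {a..b} p" using p by (rule solves_ode_on_continuous)
  define z where "z = (\<lambda>k t. (u k t - p t) /\<^sub>R \<mu> k)"
  define R where "R = (\<lambda>k t. f t (u k t) - f t (p t) - Dx f t (p t) (u k t - p t))"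
  have z: "solves_ode_on (linearized f p (\<lambda>t. R k t /\<^sub>R \<mu> k + E k t /\<^sub>R \<mu> k)) {a..b} (z k)" for k
    unfolding solves_ode_on_def
  proof
    fix t assume "t \<in> {a..b}"
    then have "(z k has_vector_derivative (f t (u k t) + E k t - f t (p t)) /\<^sub>R \<mu> k)
        (at t within {a..b})"
      unfolding z_def using u p
      by (auto intro!: derivative_eq_intros simp: solves_ode_on_def)
    moreover have "(f t (u k t) + E k t - f t (p t)) /\<^sub>R \<mu> k
        = Dx f t (p t) (z k t) + (R k t /\<^sub>R \<mu> k + E k t /\<^sub>R \<mu> k)"
      unfolding z_def linear_scale[OF Dx_linear[OF C1]] R_def by (simp add: algebra_simps)
    ultimately show "(z k has_vector_derivative
        Dx f t (p t) (z k t) + (R k t /\<^sub>R \<mu> k + E k t /\<^sub>R \<mu> k)) (at t within {a..b})" by simp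
  qed
  obtain C d where C: "0 \<le> C" "0 < d" "perturbation_bound f {a..b} p C d"
    using perturbation_bound_exists[OF C1 p \<open>a \<le> b\<close>] .
  obtain D where D: "0 < D" "\<And>k. norm (z k s) \<le> D"
    using convergent_imp_Bseq[OF convergentI[OF init]] unfolding z_def Bseq_def by blast
  obtain B where B: "\<And>t. t \<in> {a..b} \<Longrightarrow> norm (h t) \<le> B" "B > 0"
    using h unfolding bounded_pos by blast
  define Q where "Q = C * (D + (B + 1))"
  have Q: "Q \<ge> 0" using C D B by (simp add: Q_def)
  have scale: "norm (v /\<^sub>R \<mu> k) = norm v / \<mu> k" for v :: 'a and k
    using \<mu>(1)[of k] by (simp add: divide_inverse mult.commute)
  have \<mu>small: "\<forall>\<^sub>F k in sequentially. K * \<mu> k < e" if "e > 0" for K e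
    using order_tendstoD(2)[OF tendsto_mult_left[OF \<mu>(2), of K], of e] that by simp
  have "\<forall>\<^sub>F k in sequentially. \<forall>t\<in>{a..b}. dist (E k t /\<^sub>R \<mu> k) (h t) < 1"
    using E unfolding uniform_limit_iff by auto
  with \<mu>small[OF C(2), of "D + (B + 1)"]
  have close: "\<forall>\<^sub>F k in sequentially. \<forall>t\<in>{a..b}. norm (u k t - p t) \<le> Q * \<mu> k"
  proof eventually_elim
    case (elim k)
    have us: "norm (u k s - p s) \<le> D * \<mu> k"
      using D(2)[of k] \<mu>(1)[of k] unfolding z_def scale by (simp add: pos_divide_le_eq)
    have E': "norm (E k t) \<le> (B + 1) * \<mu> k" if "t \<in> {a..b}" for t
    proof -
      have "norm (E k t /\<^sub>R \<mu> k - h t) < 1" using elim(2) that unfolding dist_norm by blast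
      then have "norm (E k t /\<^sub>R \<mu> k) \<le> norm (h t) + 1"
        using norm_triangle_ineq2[of "E k t /\<^sub>R \<mu> k" "h t"] by linarith
      also have "\<dots> \<le> B + 1" using B that by simp
      finally show ?thesis using \<mu>(1)[of k] unfolding scale by (simp add: pos_divide_le_eq)
    qed
    have sum: "norm (u k s - p s) + (B + 1) * \<mu> k \<le> (D + (B + 1)) * \<mu> k"
      using us by (simp add: algebra_simps)
    show ?case
    proof
      fix t assume t: "t \<in> {a..b}"
      have "norm (u k t - p t) \<le> C * (norm (u k s - p s) + (B + 1) * \<mu> k)"
        using s t E' B \<mu>(1)[of k] sum elim(1)
        by (intro perturbation_boundD[OF C(3) u[of k]]) (auto intro: order.strict_trans1)
      also have "\<dots> \<le> C * ((D + (B + 1)) * \<mu> k)" using sum C(1) by (rule mult_left_mono)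
      finally show "norm (u k t - p t) \<le> Q * \<mu> k" by (simp add: Q_def mult.assoc)
    qed
  qed
  have "uniform_limit {a..b} (\<lambda>k t. R k t /\<^sub>R \<mu> k) (\<lambda>t. 0) sequentially"
  proof (rule uniform_limitI)
    fix e :: real assume "e > 0"
    define e' where "e' = e / (Q + 1)"
    have e': "e' > 0" using \<open>e > 0\<close> Q by (simp add: e'_def)
    obtain r where r: "r > 0" "\<And>t v. t \<in> {a..b} \<Longrightarrow> norm (v - p t) < r \<Longrightarrow>
        norm (f t v - f t (p t) - Dx f t (p t) (v - p t)) \<le> e' * norm (v - p t)"
      using taylor_uniform_along_curve[OF C1 pc e'] by blast
    from close \<mu>small[OF r(1), of Q]
    show "\<forall>\<^sub>F k in sequentially. \<forall>t\<in>{a..b}. dist (R k t /\<^sub>R \<mu> k) 0 < e"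
    proof eventually_elim
      case (elim k)
      show ?case
      proof
        fix t assume t: "t \<in> {a..b}"
        then have near: "norm (u k t - p t) \<le> Q * \<mu> k" using elim(1) by blast
        then have "norm (R k t) \<le> e' * norm (u k t - p t)"
          unfolding R_def using elim(2) t by (intro r(2)) simp_all
        also have "\<dots> \<le> e' * (Q * \<mu> k)" using near e' by simp
        also have "\<dots> < e' * ((Q + 1) * \<mu> k)" using e' \<mu>(1)[of k] by simp
        also have "\<dots> = e * \<mu> k" using Q by (simp add: e'_def)
        finally have "norm (R k t /\<^sub>R \<mu> k) < e"
          using \<mu>(1)[of k] unfolding scale by (simp add: pos_divide_less_eq)
        then show "dist (R k t /\<^sub>R \<mu> k) 0 < e" unfolding dist_norm by simp
      qed
    qed
  qed
  from uniform_limit_add[OF this E]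
  have "uniform_limit {a..b} (\<lambda>k t. R k t /\<^sub>R \<mu> k + E k t /\<^sub>R \<mu> k) h sequentially"
    by simp
  moreover have "(\<lambda>k. z k s) \<longlonglongrightarrow> \<xi>" unfolding z_def by (rule init)
  ultimately obtain y where "solves_ode_on (linearized f p h) {a..b} y" "y s = \<xi>"
    "\<forall>t\<in>{a..b}. (\<lambda>k. z k t) \<longlonglongrightarrow> y t"
    using linearized_limit[where z = z, OF C1 pc s z] by blast
  then show thesis using that[of y] unfolding z_def by blast
qed

text \<open>The solution is the directional derivative of the flow, obtained as a limit of difference quotients.\<close>

lemma homogeneous_solution_exists:
  fixes f :: "real \<Rightarrow> 'a::euclidean_space \<Rightarrow> 'a"
  assumes C1: "C1_map (\<lambda>(t, v). f t v)" and p: "solves_ode_on f {a..b} p" and s: "s \<in> {a..b}"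
    and ext: "\<And>\<xi>. \<exists>u. solves_ode_on f {a..b} u \<and> u s = \<xi>"
  shows "\<exists>y. solves_ode_on (linearized f p (\<lambda>_. 0)) {a..b} y \<and> y s = \<xi>"
proof -
  define \<mu> where "\<mu> = (\<lambda>k. inverse (real (Suc k)))"
  have \<mu>: "\<mu> k > 0" for k by (simp add: \<mu>_def)
  have "\<forall>k. \<exists>u. solves_ode_on f {a..b} u \<and> u s = p s + \<mu> k *\<^sub>R \<xi>" using ext by blast
  then obtain u where u: "\<And>k. solves_ode_on f {a..b} (u k)" "\<And>k. u k s = p s + \<mu> k *\<^sub>R \<xi>"
    by metis
  show ?thesis
  proof (rule rescaled_difference_limit[OF C1 p s, where u = u and \<mu> = \<mu> and E = "\<lambda>_ _. 0"
        and \<xi> = \<xi> and h = "\<lambda>_. 0"])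
    show "\<mu> \<longlonglongrightarrow> 0" unfolding \<mu>_def by (rule LIMSEQ_inverse_real_of_nat)
    show "(\<lambda>k. (u k s - p s) /\<^sub>R \<mu> k) \<longlonglongrightarrow> \<xi>" using \<mu> by (simp add: u(2) less_imp_neq[symmetric])
    show "bounded ((\<lambda>_. 0) ` {a..b})" by (auto simp: image_constant_conv)
  qed (use u \<mu> in \<open>auto simp: uniform_limit_iff\<close>)
qed

section \<open>The derivative of the flow and the function eta\<close>

text \<open>With \<open>h = v - p s\<close>, the error of the linear approximation, \<open>u - p - Y h\<close>, vanishes at s and is driven
only by the Taylor remainder, which is o(|h|).\<close>

lemma Omega_differentiable:
  fixes f :: "real \<Rightarrow> 'a::euclidean_space \<Rightarrow> 'a"
  assumes C1: "C1_map (\<lambda>(t, v). f t v)" and p: "solves_ode_on f {a..b} p"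
    and s: "s \<in> {a..b}" and t: "t \<in> {a..b}"
    and ext: "\<And>\<xi>. \<exists>u. solves_ode_on f {a..b} u \<and> u s = \<xi>"
    and Y: "\<And>\<xi>. solves_ode_on (linearized f p (\<lambda>_. 0)) {a..b} (Y \<xi>)" "\<And>\<xi>. Y \<xi> s = \<xi>"
  shows "(Omega f t s has_derivative (\<lambda>\<xi>. Y \<xi> t)) (at (p s))"
  unfolding has_derivative_at_alt
proof (intro conjI allI impI)
  have "a \<le> b" using s by simp
  have pc: "continuous_on {a..b} p" using p by (rule solves_ode_on_continuous)
  have comb: "Y (\<alpha> *\<^sub>R \<xi> + \<beta> *\<^sub>R \<zeta>) t = \<alpha> *\<^sub>R Y \<xi> t + \<beta> *\<^sub>R Y \<zeta> t" for \<alpha> \<beta> \<xi> \<zeta>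
  proof (rule linearized_unique[OF C1 pc Y(1) _ s _ t])
    show "solves_ode_on (linearized f p (\<lambda>_. 0)) {a..b} (\<lambda>t. \<alpha> *\<^sub>R Y \<xi> t + \<beta> *\<^sub>R Y \<zeta> t)"
      using linearized_combine[OF C1 Y(1)[of \<xi>] Y(1)[of \<zeta>], of \<alpha> \<beta>] by simp
  qed (simp add: Y(2))
  have "linear (\<lambda>\<xi>. Y \<xi> t)"
  proof (rule linearI)
    show "Y (\<xi> + \<zeta>) t = Y \<xi> t + Y \<zeta> t" for \<xi> \<zeta> using comb[of 1 _ 1] by simp
    show "Y (c *\<^sub>R \<xi>) t = c *\<^sub>R Y \<xi> t" for c \<xi> using comb[of c _ 0] by simp
  qed
  then show "bounded_linear (\<lambda>\<xi>. Y \<xi> t)" by (simp add: linear_conv_bounded_linear)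
  fix e :: real assume "e > 0"
  obtain C d where C: "0 \<le> C" "0 < d" "perturbation_bound f {a..b} p C d"
    using perturbation_bound_exists[OF C1 p \<open>a \<le> b\<close>] .
  obtain C' where C': "0 \<le> C'" "linearized_bound f {a..b} p C'"
    using linearized_bound_exists[OF C1 pc \<open>a \<le> b\<close>] .
  define e' where "e' = e / (C' * C + 1)"
  have e': "e' > 0" using \<open>e > 0\<close> C C' by (simp add: e'_def add_nonneg_pos)
  obtain r where r: "r > 0" "\<And>t v. t \<in> {a..b} \<Longrightarrow> norm (v - p t) < r \<Longrightarrow>
      norm (f t v - f t (p t) - Dx f t (p t) (v - p t)) \<le> e' * norm (v - p t)"
    using taylor_uniform_along_curve[OF C1 pc e'] by blast
  define q where "q = min d (r / (C + 1))"
  have "q > 0" using C r by (simp add: q_def)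
  have "norm (Omega f t s v - Omega f t s (p s) - Y (v - p s) t) \<le> e * norm (v - p s)"
    if v: "norm (v - p s) < q" for v
  proof -
    obtain u where u: "solves_ode_on f {a..b} u" "u s = v" using ext by blast
    have near: "norm (u t - p t) \<le> C * norm (v - p s)" if "t \<in> {a..b}" for t
    proof -
      have "norm (u t - p t) \<le> C * (norm (u s - p s) + 0)"
        by (rule perturbation_boundD[OF C(3), of "\<lambda>_. 0"]) (use u s that v in \<open>auto simp: q_def\<close>)
      then show ?thesis by (simp add: u(2))
    qed
    have "C * norm (v - p s) \<le> (C + 1) * norm (v - p s)" by (simp add: mult_right_mono)
    also have "\<dots> < r" using v C(1) by (simp add: q_def pos_less_divide_eq mult.commute)
    finally have near': "norm (u t - p t) < r" if "t \<in> {a..b}" for t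
      using near[OF that] by simp
    define R where "R = (\<lambda>t. f t (u t) - f t (p t) - Dx f t (p t) (u t - p t))"
    have "solves_ode_on (linearized f p R) {a..b} (\<lambda>t. u t - p t)"
      using u(1) p unfolding solves_ode_on_def R_def
      by (auto intro!: derivative_eq_intros)
    from linearized_diff[OF C1 this Y(1)]
    have "solves_ode_on (linearized f p R) {a..b} (\<lambda>t. u t - p t - Y (v - p s) t)" by simp
    then have "norm (u t - p t - Y (v - p s) t)
        \<le> C' * (norm (u s - p s - Y (v - p s) s) + e' * (C * norm (v - p s)))"
    proof (rule linearized_boundD[OF C'(2) _ _ s t])
      fix t assume t: "t \<in> {a..b}"
      have "norm (R t) \<le> e' * norm (u t - p t)" unfolding R_def using r(2) t near' by blast
      also have "\<dots> \<le> e' * (C * norm (v - p s))" using near[OF t] e' by simp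
      finally show "norm (R t) \<le> e' * (C * norm (v - p s))" .
    qed
    also have "\<dots> = e' * (C' * C) * norm (v - p s)" by (simp add: u(2) Y(2))
    also have "\<dots> \<le> e' * (C' * C + 1) * norm (v - p s)"
      using e' by (intro mult_right_mono mult_left_mono) auto
    also have "e' * (C' * C + 1) = e"
      using add_nonneg_pos[of "C' * C" 1] C(1) C'(1) by (simp add: e'_def)
    finally show ?thesis
      using Omega_eq[OF C1 u(1) s t] Omega_eq[OF C1 p s t] u(2) by simp
  qed
  with \<open>q > 0\<close> show "\<exists>d>0. \<forall>v. norm (v - p s) < d \<longrightarrow>
      norm (Omega f t s v - Omega f t s (p s) - Y (v - p s) t) \<le> e * norm (v - p s)"
    by blast
qed

lemma Omega_deriv_eq:
  fixes f :: "real \<Rightarrow> 'a::euclidean_space \<Rightarrow> 'a"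
  assumes C1: "C1_map (\<lambda>(t, v). f t v)" and p: "solves_ode_on f {a..b} p"
    and s: "s \<in> {a..b}" and t: "t \<in> {a..b}"
    and ext: "\<And>\<xi>. \<exists>u. solves_ode_on f {a..b} u \<and> u s = \<xi>"
    and y: "solves_ode_on (linearized f p (\<lambda>_. 0)) {a..b} y"
  shows "Omega_deriv f t s (p s) (y s) = y t" and "linear (Omega_deriv f t s (p s))"
proof -
  have "\<forall>\<xi>. \<exists>y. solves_ode_on (linearized f p (\<lambda>_. 0)) {a..b} y \<and> y s = \<xi>"
    by (intro allI homogeneous_solution_exists[OF C1 p s ext])
  from choice[OF this] obtain Y where
    Y: "\<And>\<xi>. solves_ode_on (linearized f p (\<lambda>_. 0)) {a..b} (Y \<xi>)" "\<And>\<xi>. Y \<xi> s = \<xi>" by blast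
  note der = Omega_differentiable[OF C1 p s t ext Y]
  have eq: "Omega_deriv f t s (p s) = (\<lambda>\<xi>. Y \<xi> t)"
    unfolding Omega_deriv_def by (rule frechet_derivative_at[OF der, symmetric])
  have "Y (y s) t = y t"
    by (rule linearized_unique[where y = "Y (y s)",
          OF C1 solves_ode_on_continuous[OF p] Y(1) y s Y(2) t])
  then show "Omega_deriv f t s (p s) (y s) = y t" by (simp add: eq)
  show "linear (Omega_deriv f t s (p s))" unfolding eq using der by (rule has_derivative_linear)
qed

lemma eta_eq:
  fixes f :: "real \<Rightarrow> 'a::euclidean_space \<Rightarrow> 'a"
  assumes C1: "C1_map (\<lambda>(t, v). f t v)" and p: "solves_ode_on f {a..b} p"
    and 0: "0 \<in> {a..b}" and s: "s \<in> {a..b}" and t: "t \<in> {a..b}"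
    and y: "solves_ode_on (linearized f p (\<lambda>t. g t (p t) 0)) {a..b} y" and "y s = 0"
  shows "eta f g t s (p 0) = y t"
proof -
  let ?F = "\<lambda>\<tau> y. Dx f \<tau> (Omega f \<tau> 0 (p 0)) y + g \<tau> (Omega f \<tau> 0 (p 0)) 0"
  have F: "?F \<tau> v = Dx f \<tau> (p \<tau>) v + g \<tau> (p \<tau>) 0" if "\<tau> \<in> {a..b}" for \<tau> v
    using Omega_eq[OF C1 p 0 that] by simp
  have "ivp_value ?F t s (y s) = y t"
  proof (rule ivp_value_eq[OF _ s t])
    show "solves_ode_on ?F {a..b} y" by (rule solves_ode_on_cong[OF y]) (simp add: F)
    fix c d z assume cd: "{c..d} \<subseteq> {a..b}" and st: "s \<in> {c..d}" "t \<in> {c..d}"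
      and z: "solves_ode_on ?F {c..d} z" "z s = y s"
    have zl: "solves_ode_on (linearized f p (\<lambda>t. g t (p t) 0)) {c..d} z"
      by (rule solves_ode_on_cong[OF z(1)]) (use cd in \<open>auto simp: F\<close>)
    show "z t = y t"
    proof (rule linearized_unique[where p = p and c = "\<lambda>t. g t (p t) 0" and s = s, OF C1])
      show "continuous_on {c..d} p"
        by (rule continuous_on_subset[OF solves_ode_on_continuous[OF p] cd])
      show "solves_ode_on (linearized f p (\<lambda>t. g t (p t) 0)) {c..d} y"
        by (rule solves_ode_on_subset[OF y cd])
    qed (fact zl st z(2))+
  qed
  then show ?thesis using \<open>y s = 0\<close> by (simp add: eta_def)
qed

section \<open>Perturbed solutions converge uniformly\<close>

lemma uniform_limit_parameter_compose:
  fixes G :: "real \<Rightarrow> 'a::euclidean_space \<Rightarrow> real \<Rightarrow> 'b::metric_space"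
  assumes G: "continuous_on (UNIV \<times> UNIV \<times> {0..1}) (\<lambda>(t, v, e). G t v e)"
    and p: "continuous_on {a..b} p" and x: "uniform_limit {a..b} x p sequentially"
    and \<epsilon>: "\<And>k. \<epsilon> k \<in> {0..1}" "\<epsilon> \<longlonglongrightarrow> 0"
  shows "uniform_limit {a..b} (\<lambda>k t. G t (x k t) (\<epsilon> k)) (\<lambda>t. G t (p t) 0) sequentially"
proof -
  have "bounded (p ` {a..b})"
    by (intro compact_imp_bounded compact_continuous_image p) auto
  then obtain R where R: "\<And>t. t \<in> {a..b} \<Longrightarrow> norm (p t) \<le> R" unfolding bounded_pos by blast
  define K where "K = {a..b} \<times> cball (0::'a) (R + 1) \<times> {0..1::real}"
  have "compact K" unfolding K_def by (intro compact_Times) auto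
  have uc: "uniformly_continuous_on K (\<lambda>(t, v, e). G t v e)"
    by (intro compact_uniformly_continuous \<open>compact K\<close> continuous_on_subset[OF G])
      (auto simp: K_def)
  have lim: "uniform_limit {a..b} (\<lambda>k t. (t, x k t, \<epsilon> k)) (\<lambda>t. (t, p t, 0)) sequentially"
  proof (rule uniform_limitI)
    fix e :: real assume "e > 0"
    then have "\<forall>\<^sub>F k in sequentially. \<forall>t\<in>{a..b}. dist (x k t) (p t) < e / 2"
      "\<forall>\<^sub>F k in sequentially. dist (\<epsilon> k) 0 < e / 2"
      using x \<epsilon>(2) half_gt_zero unfolding uniform_limit_iff tendsto_iff by blast+
    then show "\<forall>\<^sub>F k in sequentially. \<forall>t\<in>{a..b}. dist (t, x k t, \<epsilon> k) (t, p t, 0) < e"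
    proof eventually_elim
      case (elim k)
      show ?case
      proof
        fix t assume "t \<in> {a..b}"
        have "dist (t, x k t, \<epsilon> k) (t, p t, 0) \<le> dist (x k t) (p t) + dist (\<epsilon> k) 0"
          using sqrt_sum_squares_le_sum[of "dist (x k t) (p t)" "dist (\<epsilon> k) 0"]
          by (simp add: dist_Pair_Pair)
        also have "\<dots> < e / 2 + e / 2"
          using elim \<open>t \<in> {a..b}\<close> by (intro add_strict_mono) auto
        finally show "dist (t, x k t, \<epsilon> k) (t, p t, 0) < e" by simp
      qed
    qed
  qed
  have "\<forall>\<^sub>F k in sequentially. \<forall>t\<in>{a..b}. dist (x k t) (p t) < 1"
    using x unfolding uniform_limit_iff by auto
  then have "\<forall>\<^sub>F k in sequentially. \<forall>t\<in>{a..b}. (t, x k t, \<epsilon> k) \<in> K"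
  proof eventually_elim
    case (elim k)
    show ?case
    proof
      fix t assume t: "t \<in> {a..b}"
      have "norm (x k t) \<le> norm (p t) + dist (x k t) (p t)"
        unfolding dist_norm by (rule norm_triangle_sub)
      also have "\<dots> \<le> R + 1" using R[OF t] bspec[OF elim t] by linarith
      finally show "(t, x k t, \<epsilon> k) \<in> K" using t \<epsilon>(1)[of k] by (simp add: K_def)
    qed
  qed
  from uniform_limit_compose_uniformly_continuous_on[OF lim uc this compact_imp_closed[OF \<open>compact K\<close>]]
  show ?thesis by simp
qed

text \<open>Convergence at a single time suffices: near p the perturbation is at most \<epsilon> M, where M bounds g on
a compact set that contains the tube of radius 1 around p.\<close>

lemma perturbed_uniform_limit:
  fixes f :: "real \<Rightarrow> 'a::euclidean_space \<Rightarrow> 'a"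
  assumes C1: "C1_map (\<lambda>(t, v). f t v)" and p: "solves_ode_on f {a..b} p" and s: "s \<in> {a..b}"
    and g: "continuous_on (UNIV \<times> UNIV \<times> {0..1}) (\<lambda>(t, v, e). g t v e)"
    and \<epsilon>: "\<And>k. \<epsilon> k \<in> {0..1}" "\<epsilon> \<longlonglongrightarrow> 0"
    and x: "\<And>k. solves_ode_on (\<lambda>t v. f t v + \<epsilon> k *\<^sub>R g t v (\<epsilon> k)) {a..b} (x k)"
    and init: "(\<lambda>k. x k s) \<longlonglongrightarrow> p s"
  shows "uniform_limit {a..b} x p sequentially"
proof -
  have "a \<le> b" using s by simp
  have pc: "continuous_on {a..b} p" using p by (rule solves_ode_on_continuous)
  have "bounded (p ` {a..b})"
    by (intro compact_imp_bounded compact_continuous_image pc) auto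
  then obtain R where R: "\<And>t. t \<in> {a..b} \<Longrightarrow> norm (p t) \<le> R" unfolding bounded_pos by blast
  define K where "K = {a..b} \<times> cball (0::'a) (R + 1) \<times> {0..1::real}"
  have "bounded ((\<lambda>(t, v, e). g t v e) ` K)"
    by (intro compact_imp_bounded compact_continuous_image continuous_on_subset[OF g])
      (auto simp: K_def intro!: compact_Times)
  then obtain M where M: "M > 0" "\<forall>w\<in>(\<lambda>(t, v, e). g t v e) ` K. norm w \<le> M"
    unfolding bounded_pos by blast
  have gM: "norm (g t v e) \<le> M" if "(t, v, e) \<in> K" for t v e
    using M(2) that by force
  obtain C d where C: "0 \<le> C" "0 < d" "perturbation_bound f {a..b} p C d"
    using perturbation_bound_exists[OF C1 p \<open>a \<le> b\<close>] .
  define S where "S = (\<lambda>k. norm (x k s - p s) + \<epsilon> k * M)"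
  have S0: "S \<longlonglongrightarrow> norm (p s - p s) + 0 * M"
    unfolding S_def by (intro tendsto_intros init \<epsilon>)
  then have CS: "(\<lambda>k. C * S k) \<longlonglongrightarrow> 0" using tendsto_mult_left[OF S0, of C] by simp
  have near: "\<forall>\<^sub>F k in sequentially. \<forall>t\<in>{a..b}. norm (x k t - p t) \<le> C * S k"
  proof -
    have "\<forall>\<^sub>F k in sequentially. S k < d" using order_tendstoD(2)[OF S0] C(2) by simp
    then show ?thesis
    proof eventually_elim
      case (elim k)
      have "norm (\<epsilon> k *\<^sub>R g t (x k t) (\<epsilon> k)) \<le> \<epsilon> k * M"
        if t: "t \<in> {a..b}" and "norm (x k t - p t) < 1" for t
      proof -
        have "norm (x k t) \<le> R + 1"
          using norm_triangle_sub[of "x k t" "p t"] R[OF t] that by simp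
        then have "(t, x k t, \<epsilon> k) \<in> K" using t \<epsilon>(1)[of k] by (simp add: K_def)
        then show ?thesis using gM \<epsilon>(1)[of k] by (simp add: mult_left_mono)
      qed
      moreover have "solves_ode_on (\<lambda>t v. f t v + \<epsilon> k *\<^sub>R g t (x k t) (\<epsilon> k)) {a..b} (x k)"
        by (rule solves_ode_on_cong[OF x]) simp
      ultimately show ?case
        using elim s M(1) \<epsilon>(1)[of k] unfolding S_def
        by (intro ballI perturbation_boundD[OF C(3)]) auto
    qed
  qed
  show ?thesis
  proof (rule uniform_limitI)
    fix e :: real assume "e > 0"
    with CS have "\<forall>\<^sub>F k in sequentially. C * S k < e"
      by (rule order_tendstoD)
    with near show "\<forall>\<^sub>F k in sequentially. \<forall>t\<in>{a..b}. dist (x k t) (p t) < e"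
      by eventually_elim (force simp: dist_norm)
  qed
qed

section \<open>Periodic solutions of the perturbed equation\<close>

text \<open>The indices tend to infinity by themselves: values of r at indices below N are bounded, so they
cannot exceed j for large j.\<close>

lemma unbounded_sequence_selection:
  fixes r :: "nat \<Rightarrow> real"
  assumes "\<And>c. c > 0 \<Longrightarrow> \<exists>k. c < r k"
  obtains \<kappa> where "filterlim \<kappa> at_top sequentially" "\<And>j. real (Suc j) < r (\<kappa> j)"
proof -
  have "\<forall>j. \<exists>k. real (Suc j) < r k" using assms by (meson of_nat_0_less_iff zero_less_Suc)
  then obtain \<kappa> where \<kappa>: "\<And>j. real (Suc j) < r (\<kappa> j)" by metis
  have "filterlim \<kappa> at_top sequentially"
    unfolding filterlim_at_top
  proof
    fix N
    obtain m :: nat where m: "\<And>k. k < N \<Longrightarrow> r k \<le> real m"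
    proof
      show "r k \<le> real (nat \<lceil>Max (insert 0 (r ` {..<N}))\<rceil>)" if "k < N" for k
        using that by (intro order_trans[OF _ real_nat_ceiling_ge] Max_ge) auto
    qed
    show "\<forall>\<^sub>F j in sequentially. N \<le> \<kappa> j"
    proof (rule eventually_sequentiallyI)
      fix j assume "m \<le> j"
      show "N \<le> \<kappa> j"
        using m[of "\<kappa> j"] \<kappa>[of j] \<open>m \<le> j\<close> by (cases "\<kappa> j < N") auto
    qed
  qed
  then show thesis using \<kappa> that by blast
qed

theorem mainTheorem9:
  fixes T :: real
    and f :: "real \<Rightarrow> real ^ 'n \<Rightarrow> real ^ 'n"
    and g :: "real \<Rightarrow> real ^ 'n \<Rightarrow> real \<Rightarrow> real ^ 'n"
    and \<epsilon> :: "nat \<Rightarrow> real"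
    and x :: "nat \<Rightarrow> real \<Rightarrow> real ^ 'n"
    and xt :: "real \<Rightarrow> real ^ 'n"
    and l :: "real ^ 'n"
  assumes T_pos: "T > 0"
    and f_C1: "C1_map (\<lambda>(t, v). f t v)"
    and g_cont: "continuous_on (UNIV \<times> UNIV \<times> {0..1}) (\<lambda>(t, v, e). g t v e)"
    and f_per: "\<And>t v. f (t + T) v = f t v"
    and g_per: "\<And>t v e. e \<in> {0..1} \<Longrightarrow> g (t + T) v e = g t v e"
    and extend: "\<And>t0 \<xi>. t0 \<in> {0..T} \<Longrightarrow> \<exists>y. solves_ode_on f {0..T} y \<and> y t0 = \<xi>"
    and eps_range: "\<And>k. \<epsilon> k \<in> {0<..1}"
    and eps_lim: "\<epsilon> \<longlonglongrightarrow> 0"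
    and x_sol: "\<And>k. periodic_solution T (\<lambda>t v. f t v + \<epsilon> k *\<^sub>R g t v (\<epsilon> k)) (x k)"
    and xt_sol: "periodic_solution T f xt"
    and x_lim: "\<And>t. (\<lambda>k. x k t) \<longlonglongrightarrow> xt t"
    and x_neq: "\<And>k. x k 0 \<noteq> xt 0"
    and l_lim: "(\<lambda>k. (xt 0 - x k 0) /\<^sub>R norm (xt 0 - x k 0)) \<longlonglongrightarrow> l"
  shows "(Omega_deriv f T 0 (xt 0) l - l = 0
            \<or> (\<exists>c>0. \<forall>k. norm (xt 0 - x k 0) \<le> c * \<epsilon> k))
       \<and> ((\<exists>c>0. \<forall>k. norm (xt 0 - x k 0) \<le> c * \<epsilon> k)
            \<longrightarrow> convergent (\<lambda>k. (xt 0 - x k 0) /\<^sub>R \<epsilon> k)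
            \<longrightarrow> (\<forall>t\<in>{0..T}.
                  convergent (\<lambda>k. (xt 0 - Omega f 0 t (x k t)) /\<^sub>R \<epsilon> k)
                \<and> Omega_deriv f T 0 (xt 0) (lim (\<lambda>k. (xt 0 - Omega f 0 t (x k t)) /\<^sub>R \<epsilon> k))
                    - lim (\<lambda>k. (xt 0 - Omega f 0 t (x k t)) /\<^sub>R \<epsilon> k)
                  = gen_averaging T f g t (xt 0)))"
proof -
  have T: "0 \<in> {0..T}" "T \<in> {0..T}" using T_pos by auto
  have p: "solves_ode_on f {0..T} xt" and pT: "xt T = xt 0"
    using xt_sol solves_ode_on_subset unfolding periodic_solution_def by (blast, metis add_0)
  have pc: "continuous_on {0..T} xt" using p by (rule solves_ode_on_continuous)
  have x: "solves_ode_on (\<lambda>t v. f t v + \<epsilon> k *\<^sub>R g t v (\<epsilon> k)) {0..T} (x k)"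
    and xT: "x k T = x k 0" for k
    using x_sol[of k] solves_ode_on_subset unfolding periodic_solution_def by (blast, metis add_0)
  have \<epsilon>: "0 < \<epsilon> k" "\<epsilon> k \<in> {0..1}" for k using eps_range[of k] by auto
  have x': "solves_ode_on (\<lambda>t v. f t v + \<epsilon> k *\<^sub>R g t (x k t) (\<epsilon> k)) {0..T} (x k)" for k
    by (rule solves_ode_on_cong[OF x]) simp
  have xunif: "uniform_limit {0..T} x xt sequentially"
    by (rule perturbed_uniform_limit[OF f_C1 p T(1) g_cont \<epsilon>(2) eps_lim x x_lim])
  define g0 where "g0 = (\<lambda>t. g t (xt t) 0)"
  have gunif: "uniform_limit {0..T} (\<lambda>k t. g t (x k t) (\<epsilon> k)) g0 sequentially"
    unfolding g0_def by (rule uniform_limit_parameter_compose[OF g_cont pc xunif \<epsilon>(2) eps_lim])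
  have "continuous_on {0..T} (\<lambda>t. (\<lambda>(t, v, e). g t v e) (t, xt t, 0))"
    by (intro continuous_on_compose2[OF g_cont] continuous_intros pc) auto
  then have g0b: "bounded (g0 ` {0..T})"
    unfolding g0_def by (intro compact_imp_bounded compact_continuous_image) auto
  note D = Omega_deriv_eq[OF f_C1 p T extend[OF T(1)]]
  have Dlin: "linear (Omega_deriv f T 0 (xt 0))"
  proof -
    obtain y where "solves_ode_on (linearized f xt (\<lambda>_. 0)) {0..T} y"
      using homogeneous_solution_exists[OF f_C1 p T(1) extend[OF T(1)]] by blast
    then show ?thesis by (rule D(2))
  qed
  have first: "Omega_deriv f T 0 (xt 0) l - l = 0"
    if unbounded: "\<not> (\<exists>c>0. \<forall>k. norm (xt 0 - x k 0) \<le> c * \<epsilon> k)"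
  proof -
    have "\<exists>k. c < norm (xt 0 - x k 0) / \<epsilon> k" if "c > 0" for c
      using unbounded that \<epsilon>(1) by (auto simp: pos_less_divide_eq not_le)
    then obtain \<kappa> where \<kappa>: "filterlim \<kappa> at_top sequentially"
      "\<And>j. real (Suc j) < norm (xt 0 - x (\<kappa> j) 0) / \<epsilon> (\<kappa> j)"
      using unbounded_sequence_selection[of "\<lambda>k. norm (xt 0 - x k 0) / \<epsilon> k"] by blast
    define \<mu> where "\<mu> = (\<lambda>j. norm (xt 0 - x (\<kappa> j) 0))"
    have \<mu>0: "0 < \<mu> j" for j using x_neq[of "\<kappa> j"] by (simp add: \<mu>_def)
    have "(\<lambda>k. norm (xt 0 - x k 0)) \<longlonglongrightarrow> norm (xt 0 - xt 0)" by (intro tendsto_intros x_lim)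
    from filterlim_compose[OF this \<kappa>(1)] have \<mu>lim: "\<mu> \<longlonglongrightarrow> 0" by (simp add: \<mu>_def)
    have ratio: "(\<lambda>j. \<epsilon> (\<kappa> j) / \<mu> j) \<longlonglongrightarrow> 0"
    proof (rule tendsto_sandwich[OF _ _ tendsto_const LIMSEQ_inverse_real_of_nat])
      show "\<forall>\<^sub>F j in sequentially. 0 \<le> \<epsilon> (\<kappa> j) / \<mu> j"
        using \<epsilon>(1) \<mu>0 by (intro always_eventually allI divide_nonneg_pos less_imp_le)
      have "\<epsilon> (\<kappa> j) / \<mu> j \<le> inverse (real (Suc j))" for j
      proof -
        have "real (Suc j) * \<epsilon> (\<kappa> j) \<le> \<mu> j"
          using \<kappa>(2)[of j] \<epsilon>(1)[of "\<kappa> j"] by (simp only: \<mu>_def pos_less_divide_eq less_imp_le)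
        then show ?thesis
          using \<mu>0[of j] by (simp add: pos_divide_le_eq inverse_eq_divide pos_le_divide_eq mult.commute
              del: of_nat_Suc)
      qed
      then show "\<forall>\<^sub>F j in sequentially. \<epsilon> (\<kappa> j) / \<mu> j \<le> inverse (real (Suc j))" by simp
    qed
    have gk: "uniform_limit {0..T} (\<lambda>j t. g t (x (\<kappa> j) t) (\<epsilon> (\<kappa> j))) g0 sequentially"
      by (rule filterlim_compose[OF gunif \<kappa>(1)])
    have rk: "uniform_limit {0..T} (\<lambda>j t. \<epsilon> (\<kappa> j) / \<mu> j) (\<lambda>t. 0) sequentially"
      using ratio by (simp add: uniform_limit_iff tendsto_iff)
    have "uniform_limit {0..T} (\<lambda>j t. (\<epsilon> (\<kappa> j) / \<mu> j) *\<^sub>R g t (x (\<kappa> j) t) (\<epsilon> (\<kappa> j)))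
        (\<lambda>t. 0 *\<^sub>R g0 t) sequentially"
      by (rule bounded_bilinear.bounded_uniform_limit[OF bounded_bilinear_scaleR rk gk g0b])
        (auto simp: image_constant_conv)
    then have Ek: "uniform_limit {0..T} (\<lambda>j t. (\<epsilon> (\<kappa> j) *\<^sub>R g t (x (\<kappa> j) t) (\<epsilon> (\<kappa> j))) /\<^sub>R \<mu> j)
        (\<lambda>t. 0) sequentially"
      by (simp add: divide_inverse mult.commute)
    have "(\<lambda>j. - ((xt 0 - x (\<kappa> j) 0) /\<^sub>R norm (xt 0 - x (\<kappa> j) 0))) \<longlonglongrightarrow> - l"
      by (intro tendsto_minus filterlim_compose[OF l_lim \<kappa>(1)])
    then have init: "(\<lambda>j. (x (\<kappa> j) 0 - xt 0) /\<^sub>R \<mu> j) \<longlonglongrightarrow> - l"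
      by (simp add: \<mu>_def flip: scaleR_minus_right)
    have zb: "bounded ((\<lambda>t. 0 :: real ^ 'n) ` {0..T})" by (simp add: image_constant_conv)
    obtain y where y: "solves_ode_on (linearized f xt (\<lambda>_. 0)) {0..T} y" "y 0 = - l"
      "\<And>t. t \<in> {0..T} \<Longrightarrow> (\<lambda>j. (x (\<kappa> j) t - xt t) /\<^sub>R \<mu> j) \<longlonglongrightarrow> y t"
      using rescaled_difference_limit[where u = "\<lambda>j. x (\<kappa> j)", OF f_C1 p T(1) x' \<mu>0 \<mu>lim Ek zb init]
      by blast
    \<comment> \<open>Periodicity of both solutions: the rescaled differences agree at 0 and T.\<close>
    have "y T = - l"
      using y(3)[OF T(2)] init unfolding xT pT by (rule LIMSEQ_unique)
    with D(1)[OF y(1)] y(2) show ?thesis by (simp add: linear_neg[OF Dlin])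
  qed
  have second: "convergent (\<lambda>k. (xt 0 - Omega f 0 t (x k t)) /\<^sub>R \<epsilon> k)
      \<and> Omega_deriv f T 0 (xt 0) (lim (\<lambda>k. (xt 0 - Omega f 0 t (x k t)) /\<^sub>R \<epsilon> k))
          - lim (\<lambda>k. (xt 0 - Omega f 0 t (x k t)) /\<^sub>R \<epsilon> k)
        = gen_averaging T f g t (xt 0)"
    if conv: "convergent (\<lambda>k. (xt 0 - x k 0) /\<^sub>R \<epsilon> k)" and t: "t \<in> {0..T}" for t
  proof -
    obtain a where "(\<lambda>k. (xt 0 - x k 0) /\<^sub>R \<epsilon> k) \<longlonglongrightarrow> a" using conv convergent_def by blast
    from tendsto_minus[OF this] have init: "(\<lambda>k. (x k 0 - xt 0) /\<^sub>R \<epsilon> k) \<longlonglongrightarrow> - a"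
      by (simp flip: scaleR_minus_right)
    have Ek: "uniform_limit {0..T} (\<lambda>k t. (\<epsilon> k *\<^sub>R g t (x k t) (\<epsilon> k)) /\<^sub>R \<epsilon> k) g0 sequentially"
      using gunif \<epsilon>(1) by (simp add: less_imp_neq[symmetric])
    obtain y where y: "solves_ode_on (linearized f xt g0) {0..T} y" "y 0 = - a"
      "\<And>t. t \<in> {0..T} \<Longrightarrow> (\<lambda>k. (x k t - xt t) /\<^sub>R \<epsilon> k) \<longlonglongrightarrow> y t"
      using rescaled_difference_limit[where u = x, OF f_C1 p T(1) x' \<epsilon>(1) eps_lim Ek g0b init]
      by blast
    have yT: "y T = y 0"
      using y(3)[OF T(2)] y(3)[OF T(1)] unfolding xT pT by (rule LIMSEQ_unique)
    \<comment> \<open>Unperturbed solutions through x(k) at time t; their values at 0 are the ones in the claim.\<close>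
    have "\<forall>k. \<exists>q. solves_ode_on f {0..T} q \<and> q t = x k t" using extend[OF t] by blast
    from choice[OF this] obtain q where q: "\<And>k. solves_ode_on f {0..T} (q k)" "\<And>k. q k t = x k t"
      by blast
    have q': "solves_ode_on (\<lambda>t v. f t v + 0) {0..T} (q k)" for k using q(1) by simp
    have E0: "uniform_limit {0..T} (\<lambda>k t. (0 :: real ^ 'n) /\<^sub>R \<epsilon> k) (\<lambda>t. 0) sequentially"
      by (simp add: uniform_limit_iff)
    have zb: "bounded ((\<lambda>t. 0 :: real ^ 'n) ` {0..T})" by (simp add: image_constant_conv)
    have init': "(\<lambda>k. (q k t - xt t) /\<^sub>R \<epsilon> k) \<longlonglongrightarrow> y t" unfolding q(2) by (rule y(3)[OF t])
    obtain w where w: "solves_ode_on (linearized f xt (\<lambda>_. 0)) {0..T} w" "w t = y t"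
      "\<And>\<tau>. \<tau> \<in> {0..T} \<Longrightarrow> (\<lambda>k. (q k \<tau> - xt \<tau>) /\<^sub>R \<epsilon> k) \<longlonglongrightarrow> w \<tau>"
      using rescaled_difference_limit[where u = q, OF f_C1 p t q' \<epsilon>(1) eps_lim E0 zb init']
      by blast
    have Om: "Omega f 0 t (x k t) = q k 0" for k
      using Omega_eq[OF f_C1 q(1) t T(1), of k] q(2) by simp
    have L: "(\<lambda>k. (xt 0 - Omega f 0 t (x k t)) /\<^sub>R \<epsilon> k) \<longlonglongrightarrow> - w 0"
      using tendsto_minus[OF w(3)[OF T(1)]] unfolding Om by (simp flip: scaleR_minus_right)
    have v: "solves_ode_on (linearized f xt (\<lambda>t. g t (xt t) 0)) {0..T} (\<lambda>\<tau>. y \<tau> - w \<tau>)"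
      using linearized_diff[OF f_C1 y(1) w(1)] by (simp add: g0_def)
    have "gen_averaging T f g t (xt 0) = (y T - w T) - (y 0 - w 0)"
      using eta_eq[where g = g, OF f_C1 p T(1) t T(2) v] eta_eq[where g = g, OF f_C1 p T(1) t T(1) v] w(2)
      by (simp add: gen_averaging_def)
    then show ?thesis
      using L D(1)[OF w(1)] yT by (simp add: limI[OF L] convergentI[OF L] linear_neg[OF Dlin])
  qed
  show ?thesis using first second by blast
qed

end
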